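(* For each $n\ge 0$, the $n$th Caylerian polynomial satisfies \[ C_n(t)=\frac{1}{n!}\sum_{k=0}^n {n\brack k}\,\mathrm{fub}(k)\sum_{i=0}^k {k\brace i}\, i!\,(t-1)^{n-i}. \]
   Context: A Cayley permutation of $[n]=\{1,\dots,n\}$ is a word $w=w(1)\cdots w(n)$ of positive integers whose set of values is $\{1,\dots,k\}$ for some $k\le n$ (for $n=0$, the empty word); $\mathrm{Cay}[n]$ is the set of these. Its (weak) descent set is $\mathrm{Des}(w)=\{i\in[n-1]: w(i)\ge w(i+1)\}$ and $\mathrm{des}(w)=|\mathrm{Des}(w)|$. The Caylerian polynomial is $C_n(t)=\sum_{w\in\mathrm{Cay}[n]}t^{\mathrm{des}(w)}$. ${n\brack k}$ is the unsigned Stirling number of the first kind, ${k\brace i}$ the Stirling number of the second kind (set partitions of $[k]$ into $i$ blocks), and $\mathrm{fub}(k)$ the Fubini number (number of ordered set partitions of $[k]$, $\mathrm{fub}(0)=1$). *)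

theory Defs
  imports
    "HOL-Computational_Algebra.Polynomial"
    "HOL-Combinatorics.Stirling"
    "HOL-Library.Disjoint_Sets"
begin

definition Cay :: "nat \<Rightarrow> nat list set" where
  "Cay n = {w. length w = n \<and> (\<exists>k\<le>n. set w = {1..k})}"

(* Positions are 1-based as in w(1) ... w(n), list indices are 0-based:
   w(i) is w ! (i - 1). Descents are weak. *)
definition Des :: "nat list \<Rightarrow> nat set" where
  "Des w = {i \<in> {1..length w - 1}. w ! (i - 1) \<ge> w ! i}"

definition des :: "nat list \<Rightarrow> nat" where
  "des w = card (Des w)"

definition caylerian :: "nat \<Rightarrow> 'a::comm_ring_1 poly" where
  "caylerian n = (\<Sum>w\<in>Cay n. monom 1 (des w))"

(* An ordered set partition is the list of its blocks, without repetition. *)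
definition ordered_set_partitions :: "nat \<Rightarrow> nat set list set" where
  "ordered_set_partitions k = {Bs. distinct Bs \<and> partition_on {1..k} (set Bs)}"

definition fub :: "nat \<Rightarrow> nat" where
  "fub k = card (ordered_set_partitions k)"

lemma finite_Cay: "finite (Cay n)"
proof (rule finite_subset)
  show "Cay n \<subseteq> {w. set w \<subseteq> {1..n} \<and> length w = n}"
    by (auto simp: Cay_def)
  show "finite {w. set w \<subseteq> {1..n} \<and> length w = n}"
    by (rule finite_lists_length_eq) simp
qed

lemma finite_ordered_set_partitions: "finite (ordered_set_partitions k)"
proof (rule finite_subset)
  show "ordered_set_partitions k \<subseteq> {Bs. set Bs \<subseteq> Pow {1..k} \<and> distinct Bs}"
    by (auto simp: ordered_set_partitions_def partition_on_def)
  show "finite {Bs. set Bs \<subseteq> Pow {1..k} \<and> distinct Bs}"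
    by (rule finite_subset_distinct) simp
qed

lemma fub_0: "fub 0 = 1"
proof -
  have "ordered_set_partitions 0 = {[]}"
    by (auto simp: ordered_set_partitions_def partition_on_empty)
  then show ?thesis by (simp add: fub_def)
qed

end

theory Submission
  imports
    Defs
    "HOL-Computational_Algebra.Formal_Power_Series"
    "HOL-Library.Infinite_Set"
begin

unbundle fps_syntax

text \<open>
  Put \<open>u = t - 1\<close>. Over the alphabet \<open>{1..b}\<close>, the generating function \<open>W\<close> of all words by length and
  weak descents satisfies \<open>W = 1 + K W\<close>, where \<open>1 + u K = (1 - u z) ^ (- b)\<close>: a word counted with weight
  \<open>t = 1 + u\<close> per descent is a concatenation of nonempty weakly decreasing runs, each counted with
  weight \<open>u\<close> per inner descent. So \<open>W\<close> is the sum of the \<open>K ^ i\<close>. The coefficients of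
  \<open>(1 + u K) ^ a = (1 - u z) ^ (- a b)\<close> are rising factorials of \<open>a b\<close>, which Stirling numbers of the
  first kind expand in powers of \<open>a b\<close>. Binomial inversion turns each power \<open>a ^ m\<close> into
  \<open>i! S(m, i)\<close>, which yields \<open>K ^ i\<close>; a second inversion, in \<open>b\<close>, turns \<open>b ^ m\<close> into \<open>k! S(m, k)\<close> and
  selects the words with set of letters exactly \<open>{1..k}\<close>. Summing over \<open>k\<close> gives the Fubini numbers.
\<close>

section \<open>Binomial inversion and Stirling numbers of the second kind\<close>

text \<open>The system is triangular with diagonal entries \<open>k choose k\<close> = 1, so it can
  be solved by strong induction without division.\<close>

lemma binomial_transform_inject:
  fixes f g :: "nat \<Rightarrow> 'a::comm_ring_1"
  assumes "\<And>a. (\<Sum>i\<le>a. of_nat (a choose i) * f i) = (\<Sum>i\<le>a. of_nat (a choose i) * g i)"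
  shows "f k = g k"
proof (induction k rule: less_induct)
  case (less k)
  have "(\<Sum>i<k. of_nat (k choose i) * f i) = (\<Sum>i<k. of_nat (k choose i) * g i)"
    using less by (intro sum.cong) auto
  then show ?case
    using assms[of k] by (simp flip: lessThan_Suc_atMost)
qed

text \<open>Counts the maps from m points to a points by the size i of their image. The proof is
  algebraic, because the count of surjections in \<open>card_onto_words\<close> is itself derived
  from this identity.\<close>

lemma power_eq_sum_Stirling:
  "a ^ m = (\<Sum>i\<le>a. (a choose i) * (fact i * Stirling m i))"
proof (induction m)
  case 0
  have "(\<Sum>i\<le>a. (a choose i) * (fact i * Stirling 0 i)) = (\<Sum>i\<in>{0}. (a choose i) * (fact i * Stirling 0 i))"
    by (rule sum.mono_neutral_right) auto
  then show ?case by simp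
next
  case (Suc m)
  let ?c = "\<lambda>i. (a choose i) * fact i"
  \<comment> \<open>\<open>?c i\<close> is the falling factorial a (a - 1) ... (a - i + 1). Its next
    factor is a - i, so a times it is i times it plus the next falling factorial.\<close>
  have c: "?c i * a = ?c i * i + ?c (Suc i)" for i
  proof (cases "i \<le> a")
    case True
    have eq: "(a choose Suc i) * Suc i = (a choose i) * (a - i)"
      by (metis binomial_absorb_comp binomial_absorption mult.commute)
    have "?c (Suc i) = (a choose Suc i) * Suc i * fact i"
      by (simp add: algebra_simps)
    also have "\<dots> = ?c i * (a - i)"
      unfolding eq by (simp only: mult_ac)
    finally have "?c (Suc i) = ?c i * (a - i)" .
    then show ?thesis
      using True by (simp flip: add_mult_distrib2)
  qed (simp add: binomial_eq_0)
  have "a ^ Suc m = (\<Sum>i\<le>a. ?c i * a * Stirling m i)"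
    by (simp add: Suc sum_distrib_left algebra_simps)
  also have "\<dots> = (\<Sum>i\<le>a. ?c i * i * Stirling m i) + (\<Sum>i\<le>a. ?c (Suc i) * Stirling m i)"
    by (simp only: c add_mult_distrib sum.distrib)
  \<comment> \<open>Here the term i = 0 vanishes, and in the other sum the term i = a, as
    \<open>a choose Suc a\<close> is 0. Over the common range the recurrence of
    \<open>Stirling\<close> merges both sums.\<close>
  also have "(\<Sum>i\<le>a. ?c i * i * Stirling m i) = (\<Sum>i<a. ?c (Suc i) * Suc i * Stirling m (Suc i))"
    by (simp only: lessThan_Suc_atMost[symmetric] sum.lessThan_Suc_shift)
  also have "(\<Sum>i\<le>a. ?c (Suc i) * Stirling m i) = (\<Sum>i<a. ?c (Suc i) * Stirling m i)"
    by (simp flip: lessThan_Suc_atMost)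
  also have "(\<Sum>i<a. ?c (Suc i) * Suc i * Stirling m (Suc i)) + \<dots>
      = (\<Sum>i<a. ?c (Suc i) * Stirling (Suc m) (Suc i))"
    by (simp add: algebra_simps flip: sum.distrib)
  also have "\<dots> = (\<Sum>i\<le>a. ?c i * Stirling (Suc m) i)"
    by (simp only: lessThan_Suc_atMost[symmetric] sum.lessThan_Suc_shift) simp
  finally show ?case by (simp add: mult.assoc)
qed

section \<open>Powers of the geometric series\<close>

text \<open>The series 1 / (1 - u z), given by its coefficients because \<open>u\<close> will lie in
  a polynomial ring, where inverses are not at hand.\<close>

definition geom_fps :: "'a::comm_ring_1 \<Rightarrow> 'a fps" where
  "geom_fps u = Abs_fps (\<lambda>n. u ^ n)"

lemma geom_fps_unfold: "geom_fps u = 1 + fps_const u * fps_X * geom_fps u"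
proof (rule fps_ext)
  fix n
  show "geom_fps u $ n = (1 + fps_const u * fps_X * geom_fps u) $ n"
    by (cases n) (simp_all add: geom_fps_def mult.assoc)
qed

text \<open>Newton's binomial series for (1 - u z) ^ (- x), with the denominator n! cleared. The
  double induction follows the Pascal-like rule that \<open>geom_fps_unfold\<close> gives for the
  coefficients.\<close>

lemma geom_fps_power_nth:
  "fact n * (geom_fps u ^ x $ n) = u ^ n * pochhammer (of_nat x) n"
proof (induction n arbitrary: x)
  case 0
  then show ?case by (simp add: geom_fps_def fps_nth_power_0)
next
  case (Suc n)
  show ?case
  proof (induction x)
    case 0
    then show ?case by (simp add: pochhammer_rec)
  next
    case (Suc x)
    have "geom_fps u ^ Suc x = geom_fps u ^ x + fps_const u * (fps_X * geom_fps u ^ Suc x)"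
      by (subst power_Suc, subst geom_fps_unfold) (simp add: algebra_simps)
    then have "geom_fps u ^ Suc x $ Suc n = geom_fps u ^ x $ Suc n + u * (geom_fps u ^ Suc x $ n)"
      by (metis fps_add_nth fps_mult_left_const_nth fps_X_mult_nth diff_Suc_1 nat.simps(3))
    then have "fact (Suc n) * (geom_fps u ^ Suc x $ Suc n)
      = fact (Suc n) * (geom_fps u ^ x $ Suc n) + u * of_nat (Suc n) * (fact n * (geom_fps u ^ Suc x $ n))"
      by (simp add: algebra_simps)
    also have "\<dots> = u ^ Suc n * (pochhammer (of_nat x) (Suc n) + of_nat (Suc n) * pochhammer (of_nat (Suc x)) n)"
      by (simp only: Suc Suc.IH \<open>\<And>x. fact n * (geom_fps u ^ x $ n) = _\<close>) (simp add: algebra_simps)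
    \<comment> \<open>Both terms contain \<open>pochhammer (of_nat (Suc x)) n\<close>; the cofactors
      x and n + 1 add up to the last factor on the right.\<close>
    also have "pochhammer (of_nat x) (Suc n) + of_nat (Suc n) * pochhammer (of_nat (Suc x)) n
        = (pochhammer (of_nat (Suc x)) (Suc n) :: 'a)"
      by (simp add: pochhammer_rec[of "of_nat x"] pochhammer_Suc[of "1 + of_nat x"] algebra_simps)
    finally show ?case .
  qed
qed

section \<open>Descents under relabelling, and words grouped by their set of letters\<close>

lemma des_Cons: "des (x # w) = (if w \<noteq> [] \<and> hd w \<le> x then Suc (des w) else des w)"
proof -
  have "Des (x # w) = (if w \<noteq> [] \<and> hd w \<le> x then {1} else {}) \<union> Suc ` Des w" (is "_ = ?A \<union> _")
  proof (rule set_eqI)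
    fix i
    show "i \<in> Des (x # w) \<longleftrightarrow> i \<in> ?A \<union> Suc ` Des w"
      by (cases w; cases i; cases "i - 1") (auto simp: Des_def image_iff)
  qed
  moreover have "0 \<notin> Des w" "finite (Des w)"
    by (auto simp: Des_def)
  ultimately show ?thesis
    by (auto simp: des_def card_image card_insert_if image_iff)
qed

lemma des_Nil: "des [] = 0"
  by (simp add: des_def Des_def)

lemma des_map_strict_mono_on:
  assumes "strict_mono_on A f" and "set w \<subseteq> A"
  shows "des (map f w) = des w"
  using assms(2)
proof (induction w)
  case (Cons x w)
  have "hd (map f w) \<le> f x \<longleftrightarrow> hd w \<le> x" if "w \<noteq> []"
  proof -
    have "hd w \<in> A" "x \<in> A" using Cons.prems hd_in_set[OF that] by auto
    then show ?thesis
      using that strict_mono_on_less_eq[OF assms(1)] by (simp add: hd_map)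
  qed
  with Cons show ?case by (auto simp: des_Cons)
qed (simp add: des_Nil)

definition words :: "nat \<Rightarrow> nat \<Rightarrow> nat list set" where
  "words b n = {w. set w \<subseteq> {1..b} \<and> length w = n}"

definition onto_words :: "nat \<Rightarrow> nat \<Rightarrow> nat list set" where
  "onto_words k n = {w. set w = {1..k} \<and> length w = n}"

lemma finite_words: "finite (words b n)"
  unfolding words_def by (rule finite_lists_length_eq) simp

lemma finite_onto_words: "finite (onto_words k n)"
  by (rule finite_subset[OF _ finite_words[of k n]]) (auto simp: words_def onto_words_def)

text \<open>Words are grouped by their set of letters T. The increasing relabelling of T by {1..card
  T} keeps descents, and \<open>b choose k\<close> sets T have size k. A general \<open>g\<close>
  covers both powers of t and plain counting.\<close>

lemma sum_des_words:
  fixes g :: "nat \<Rightarrow> 'a::comm_ring_1"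
  shows "(\<Sum>w\<in>words b n. g (des w)) =
    (\<Sum>k\<le>b. of_nat (b choose k) * (\<Sum>w\<in>onto_words k n. g (des w)))"
proof -
  have relabel: "(\<Sum>w\<in>{w. set w = T \<and> length w = n}. g (des w))
      = (\<Sum>w\<in>onto_words (card T) n. g (des w))" if T: "T \<subseteq> {1..b}" for T
  proof -
    have finT: "finite T" using T finite_subset by blast
    obtain h where h: "bij_betw h {..<card T} T" "strict_mono_on {..<card T} h"
      using ex_bij_betw_strict_mono_card[OF finT] by blast
    \<comment> \<open>\<open>h\<close> enumerates T from 0, whereas letters start at 1.\<close>
    define f where "f = (\<lambda>i. h (i - 1))"
    have "bij_betw (\<lambda>i. i - 1) {1..card T} {..<card T}"
      by (rule bij_betw_byWitness[of _ Suc]) auto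
    from bij_betw_trans[OF this h(1)] have f: "bij_betw f {1..card T} T"
      by (simp add: f_def o_def)
    have mono: "strict_mono_on {1..card T} f"
      unfolding f_def by (intro strict_mono_onI strict_mono_onD[OF h(2)]) auto
    define f' where "f' = the_inv_into {1..card T} f"
    have ff': "f (f' y) = y" "f' y \<in> {1..card T}" if "y \<in> T" for y
      using f that unfolding f'_def bij_betw_def
      by (metis f_the_inv_into_f, metis the_inv_into_into order_refl)
    have f'f: "f' (f i) = i" "f i \<in> T" if "i \<in> {1..card T}" for i
      using f that unfolding f'_def bij_betw_def by (auto simp: the_inv_into_f_f)
    have im: "f ` {1..card T} = T" "f' ` T = {1..card T}"
      using ff' f'f by (auto simp: image_iff) force+
    have inv: "map f (map f' w) = w" if "set w = T" for w
      using that ff' by (auto simp: comp_def intro!: map_idI)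
    moreover have "map f' (map f w) = w" if "set w = {1..card T}" for w
      using that f'f by (auto simp: comp_def intro!: map_idI)
    moreover have "des (map f' w) = des w" if "set w = T" for w
      using des_map_strict_mono_on[OF mono, of "map f' w"] inv[OF that] that im by simp
    ultimately show ?thesis
      by (intro sum.reindex_bij_witness[of _ "map f" "map f'"])
        (simp_all add: onto_words_def im del: One_nat_def map_map)
  qed
  have "(\<Sum>w\<in>words b n. g (des w))
      = (\<Sum>T\<in>Pow {1..b}. \<Sum>w\<in>{w\<in>words b n. set w = T}. g (des w))"
    by (rule sum.group[symmetric]) (auto simp: finite_words, auto simp: words_def)
  also have "\<dots> = (\<Sum>T\<in>Pow {1..b}. \<Sum>w\<in>onto_words (card T) n. g (des w))"
  proof (rule sum.cong[OF refl])
    fix T assume T: "T \<in> Pow {1..b}"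
    then have "{w\<in>words b n. set w = T} = {w. set w = T \<and> length w = n}"
      by (auto simp: words_def)
    with relabel[of T] T show "(\<Sum>w\<in>{w\<in>words b n. set w = T}. g (des w)) =
        (\<Sum>w\<in>onto_words (card T) n. g (des w))" by simp
  qed
  also have "\<dots> = (\<Sum>k\<le>b. \<Sum>T\<in>{T\<in>Pow {1..b}. card T = k}. \<Sum>w\<in>onto_words (card T) n. g (des w))"
    by (rule sum.group[symmetric]) (auto dest: card_mono[rotated])
  also have "\<dots> = (\<Sum>k\<le>b. of_nat (b choose k) * (\<Sum>w\<in>onto_words k n. g (des w)))"
    by (intro sum.cong) (simp_all add: Pow_def n_subsets)
  finally show ?thesis .
qed

text \<open>Both sides have the binomial transform b ^ n, the number of all words over {1..b}. The
  detour through \<open>int\<close> supplies the ring that the inversion requires.\<close>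

lemma card_onto_words: "card (onto_words k n) = fact k * Stirling n k"
proof -
  have "(\<Sum>k\<le>b. int (b choose k) * int (card (onto_words k n)))
      = (\<Sum>k\<le>b. int (b choose k) * int (fact k * Stirling n k))" for b
  proof -
    have "(\<Sum>k\<le>b. int (b choose k) * int (card (onto_words k n))) = int (card (words b n))"
      using sum_des_words[of "\<lambda>_. 1 :: int" b n] by simp
    also have "\<dots> = int (b ^ n)"
      by (simp add: words_def card_lists_length_eq)
    also have "\<dots> = (\<Sum>k\<le>b. int (b choose k) * int (fact k * Stirling n k))"
      by (subst power_eq_sum_Stirling) simp
    finally show ?thesis .
  qed
  from binomial_transform_inject[OF this] show ?thesis
    using of_nat_eq_iff by blast
qed

section \<open>Cayley permutations and Fubini numbers\<close>

lemma Cay_eq_UN: "Cay n = (\<Union>k\<le>n. onto_words k n)"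
  by (auto simp: Cay_def onto_words_def)

lemma onto_words_disjoint: "k \<noteq> l \<Longrightarrow> onto_words k n \<inter> onto_words l n = {}"
  by (auto simp: onto_words_def)

lemma sum_Cay: "(\<Sum>w\<in>Cay n. f w) = (\<Sum>k\<le>n. \<Sum>w\<in>onto_words k n. f w)"
  unfolding Cay_eq_UN
  by (rule sum.UNION_disjoint) (auto simp: finite_onto_words dest: onto_words_disjoint)

text \<open>A Cayley permutation encodes the ordered set partition whose j-th block is the set of
  positions of the letter j.\<close>

lemma fub_eq_card_Cay: "fub n = card (Cay n)"
proof -
  \<comment> \<open>As the letters of a Cayley permutation form {1..k}, \<open>card (set w)\<close>
    is the largest letter k.\<close>
  define blocks where "blocks w = map (\<lambda>j. {i\<in>{1..n}. w ! (i - 1) = j}) [1..<Suc (card (set w))]"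
    for w :: "nat list"
  have "bij_betw blocks (Cay n) (ordered_set_partitions n)"
    unfolding bij_betw_def
  proof
    have mem: "i \<in> blocks w ! (j - 1) \<longleftrightarrow> i \<in> {1..n} \<and> w ! (i - 1) = j"
      if "w \<in> Cay n" "j \<in> set w" for w i j
    proof -
      from that obtain k where "set w = {1..k}" by (auto simp: Cay_def)
      with that show ?thesis by (auto simp: blocks_def nth_append simp del: upt_Suc)
    qed
    show "inj_on blocks (Cay n)"
    proof
      fix w v assume wv: "w \<in> Cay n" "v \<in> Cay n" and eq: "blocks w = blocks v"
      from wv obtain k l where kl: "set w = {1..k}" "set v = {1..l}"
        and len: "length w = n" "length v = n" by (auto simp: Cay_def)
      have "length (blocks w) = k" "length (blocks v) = l"
        using kl by (auto simp: blocks_def)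
      \<comment> \<open>Equal numbers of blocks force equal sets of letters, so that
        \<open>mem\<close> applies to v at the letter \<open>w ! i\<close>.\<close>
      with eq kl have set_eq: "set w = set v" by simp
      show "w = v"
      proof (rule nth_equalityI)
        fix i assume i: "i < length w"
        have "Suc i \<in> blocks w ! (w ! i - 1)"
          using mem[OF wv(1), of "w ! i" "Suc i"] i len by simp
        then show "w ! i = v ! i"
          using mem[OF wv(2), of "w ! i" "Suc i"] i set_eq eq nth_mem[OF i] by simp
      qed (simp add: len)
    qed
    show "blocks ` Cay n = ordered_set_partitions n"
    proof (intro equalityI subsetI)
      fix Bs assume "Bs \<in> blocks ` Cay n"
      then obtain w k where w: "w \<in> Cay n" "set w = {1..k}" "length w = n" "Bs = blocks w"
        by (auto simp: Cay_def)
      define B where "B j = {i\<in>{1..n}. w ! (i - 1) = j}" for j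
      have Bs: "Bs = map B [1..<Suc k]"
        using w by (simp add: blocks_def B_def[abs_def])
      have ne: "B j \<noteq> {}" if "j \<in> {1..k}" for j
      proof -
        from that w obtain i where "i < n" "w ! i = j" by (metis in_set_conv_nth)
        then have "Suc i \<in> B j" by (auto simp: B_def)
        then show ?thesis by blast
      qed
      have "inj_on B {1..k}"
      proof
        fix x y assume "x \<in> {1..k}" "y \<in> {1..k}" "B x = B y"
        with ne[of x] show "x = y" by (auto simp: B_def)
      qed
      then have "distinct Bs"
        by (simp add: Bs distinct_map atLeastLessThanSuc_atLeastAtMost del: upt_Suc)
      moreover have "set Bs = B ` {1..k}"
        by (simp add: Bs atLeastLessThanSuc_atLeastAtMost del: upt_Suc)
      moreover have "partition_on {1..n} (B ` {1..k})"
      proof (rule partition_onI)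
        have "w ! (i - 1) \<in> {1..k}" if "i \<in> {1..n}" for i
          using that w nth_mem[of "i - 1" w] by auto
        then show "\<Union> (B ` {1..k}) = {1..n}"
          by (auto simp: B_def)
        show "{} \<notin> B ` {1..k}"
          using ne by force
      qed (auto simp: B_def disjnt_def)
      ultimately show "Bs \<in> ordered_set_partitions n"
        by (simp add: ordered_set_partitions_def)
    next
      fix Bs assume "Bs \<in> ordered_set_partitions n"
      then have dist: "distinct Bs" and part: "partition_on {1..n} (set Bs)"
        by (auto simp: ordered_set_partitions_def)
      define k where "k = length Bs"
      have "\<exists>j<k. i \<in> Bs ! j" if "i \<in> {1..n}" for i
        using that partition_onD1[OF part] by (metis UnionE in_set_conv_nth k_def)
      \<comment> \<open>\<open>p i\<close> is the index, from 0, of the block containing i; the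
        preimage word has \<open>Suc (p i)\<close> at position i.\<close>
      then obtain p where p: "p i < k" "i \<in> Bs ! p i" if "i \<in> {1..n}" for i
        by metis
      have uniq: "j = p i" if "j < k" "i \<in> Bs ! j" for i j
      proof -
        have i: "i \<in> {1..n}"
          using that partition_onD1[OF part] nth_mem[of j Bs] by (auto simp: k_def)
        have "Bs ! j = Bs ! p i"
          using disjointD[OF partition_onD2[OF part], of "Bs ! j" "Bs ! p i"] that p[OF i]
          by (auto simp: k_def)
        then show ?thesis
          using dist that p[OF i] by (simp add: k_def nth_eq_iff_index_eq)
      qed
      have sub: "Bs ! j \<subseteq> {1..n}" "Bs ! j \<noteq> {}" if "j < k" for j
        using partition_onD1[OF part] partition_onD3[OF part] that nth_mem[of j Bs]
        unfolding k_def by (blast, metis)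
      define w where "w = map (\<lambda>i. Suc (p i)) [1..<Suc n]"
      \<comment> \<open>Blocks are nonempty, so every index is hit and no letter of {1..k} is
        missing.\<close>
      have "p ` {1..n} = {..<k}"
      proof (intro equalityI subsetI)
        fix j assume "j \<in> {..<k}"
        then obtain i where "i \<in> Bs ! j" using sub(2)[of j] by blast
        with uniq[of j i] sub(1)[of j] \<open>j \<in> {..<k}\<close> show "j \<in> p ` {1..n}" by auto
      qed (use p in auto)
      moreover have "set w = Suc ` p ` {1..n}"
        by (simp add: w_def image_image atLeastLessThanSuc_atLeastAtMost del: upt_Suc)
      ultimately have setw: "set w = {1..k}"
        by (simp add: image_Suc_lessThan)
      have lenw: "length w = n" by (simp add: w_def)
      have "k \<le> n"
        using card_length[of w] setw lenw by simp
      with setw lenw have "w \<in> Cay n" by (auto simp: Cay_def)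
      moreover have "blocks w = Bs"
      proof (rule nth_equalityI)
        fix j assume "j < length (blocks w)"
        then have j: "j < k" using setw by (simp add: blocks_def del: upt_Suc)
        have "blocks w ! j = {i\<in>{1..n}. w ! (i - 1) = Suc j}"
          using j setw by (simp add: blocks_def del: upt_Suc)
        also have "\<dots> = {i\<in>{1..n}. p i = j}"
          by (auto simp: w_def simp del: upt_Suc)
        also have "\<dots> = Bs ! j"
          using p uniq sub(1)[OF j] j by auto
        finally show "blocks w ! j = Bs ! j" .
      qed (simp add: blocks_def setw k_def del: upt_Suc)
      ultimately show "Bs \<in> blocks ` Cay n" by blast
    qed
  qed
  then show ?thesis
    by (simp add: fub_def bij_betw_same_card)
qed

lemma fub_eq_sum_Stirling: "fub n = (\<Sum>k\<le>n. fact k * Stirling n k)"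
  using sum_Cay[of "\<lambda>_. 1 :: nat" n] by (simp add: fub_eq_card_Cay card_onto_words)

section \<open>The generating function of words by length and descents\<close>

definition des_fps :: "'a::comm_ring_1 \<Rightarrow> nat \<Rightarrow> 'a fps" where
  "des_fps t b = Abs_fps (\<lambda>n. \<Sum>w\<in>words b n. t ^ des w)"

text \<open>Refining by a bound on the first letter makes the descent statistic a linear recursion in \<open>x\<close>.\<close>

definition hd_des_fps :: "'a::comm_ring_1 \<Rightarrow> nat \<Rightarrow> nat \<Rightarrow> 'a fps" where
  "hd_des_fps t b x = Abs_fps (\<lambda>n. \<Sum>w\<in>{w\<in>words b n. w \<noteq> [] \<and> hd w \<le> x}. t ^ des w)"

lemma words_0: "words b 0 = {[]}"
  by (auto simp: words_def)

lemma hd_des_fps_0: "hd_des_fps t b 0 = 0"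
proof (rule fps_ext)
  fix n
  have "{w\<in>words b n. w \<noteq> [] \<and> hd w \<le> 0} = {}"
    by (auto simp: words_def neq_Nil_conv)
  then show "hd_des_fps t b 0 $ n = 0 $ n"
    by (simp only: hd_des_fps_def fps_nth_Abs_fps sum.empty fps_zero_nth)
qed

lemma des_fps_eq_hd_des_fps: "des_fps t b = 1 + hd_des_fps t b b"
proof (rule fps_ext)
  fix n
  show "des_fps t b $ n = (1 + hd_des_fps t b b) $ n"
  proof (cases n)
    case 0
    have "{w\<in>words b 0. w \<noteq> [] \<and> hd w \<le> b} = {}"
      by (auto simp: words_0)
    then have "hd_des_fps t b b $ 0 = 0"
      by (simp only: hd_des_fps_def fps_nth_Abs_fps sum.empty)
    with 0 show ?thesis
      by (simp add: des_fps_def words_0 des_Nil)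
  next
    case (Suc m)
    have "{w\<in>words b n. w \<noteq> [] \<and> hd w \<le> b} = words b n"
      using Suc by (auto simp: words_def length_Suc_conv)
    then show ?thesis
      using Suc by (simp add: des_fps_def hd_des_fps_def)
  qed
qed

text \<open>The new words start with x + 1. Deleting that letter leaves an arbitrary word and loses
  a descent exactly if the word is nonempty with head at most x + 1; writing t = 1 + (t - 1) there
  separates the two summands.\<close>

lemma hd_des_fps_Suc:
  assumes "Suc x \<le> b"
  shows "hd_des_fps t b (Suc x) =
    hd_des_fps t b x + fps_X * (des_fps t b + fps_const (t - 1) * hd_des_fps t b (Suc x))"
proof (rule fps_ext)
  fix n
  let ?H = "\<lambda>x n. {w\<in>words b n. w \<noteq> [] \<and> hd w \<le> x}"
  show "hd_des_fps t b (Suc x) $ n =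
    (hd_des_fps t b x + fps_X * (des_fps t b + fps_const (t - 1) * hd_des_fps t b (Suc x))) $ n"
  proof (cases n)
    case 0
    have "?H y 0 = {}" for y
      by (auto simp: words_0)
    with 0 show ?thesis
      by (simp add: hd_des_fps_def del: Collect_empty_eq)
  next
    case (Suc m)
    have split: "?H (Suc x) (Suc m) = ?H x (Suc m) \<union> (#) (Suc x) ` words b m"
    proof (rule set_eqI)
      fix w
      show "w \<in> ?H (Suc x) (Suc m) \<longleftrightarrow> w \<in> ?H x (Suc m) \<union> (#) (Suc x) ` words b m"
        using assms by (cases w) (auto simp: words_def)
    qed
    have fin: "finite (?H y k)" for y k
      by (rule finite_subset[OF _ finite_words[of b k]]) auto
    have "(\<Sum>w\<in>?H (Suc x) (Suc m). t ^ des w)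
        = (\<Sum>w\<in>?H x (Suc m). t ^ des w) + (\<Sum>w\<in>(#) (Suc x) ` words b m. t ^ des w)"
      unfolding split by (rule sum.union_disjoint) (auto simp: fin finite_words)
    also have "(\<Sum>w\<in>(#) (Suc x) ` words b m. t ^ des w) = (\<Sum>w\<in>words b m. t ^ des (Suc x # w))"
      by (subst sum.reindex) auto
    also have "\<dots> = (\<Sum>w\<in>words b m. t ^ des w + (if w \<noteq> [] \<and> hd w \<le> Suc x then (t - 1) * t ^ des w else 0))"
      by (rule sum.cong) (auto simp: des_Cons algebra_simps)
    also have "\<dots> = (\<Sum>w\<in>words b m. t ^ des w) + (t - 1) * (\<Sum>w\<in>?H (Suc x) m. t ^ des w)"
      unfolding sum.distrib sum_distrib_left
      by (simp only: sum.inter_filter[OF finite_words])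
    finally show ?thesis
      using Suc by (simp add: hd_des_fps_def des_fps_def)
  qed
qed

text \<open>Closed form: \<open>((1 - u z) ^ (- x) - 1) / u\<close>. The recursion avoids dividing by \<open>u\<close>.\<close>

fun run_fps :: "'a::comm_ring_1 \<Rightarrow> nat \<Rightarrow> 'a fps" where
  "run_fps u 0 = 0"
| "run_fps u (Suc x) = (run_fps u x + fps_X) * geom_fps u"

text \<open>Brings the recursion into the implicit shape of \<open>hd_des_fps_Suc\<close>.\<close>

lemma run_fps_Suc: "run_fps u (Suc x) = run_fps u x + fps_X + fps_const u * fps_X * run_fps u (Suc x)"
proof -
  have "run_fps u (Suc x) = (run_fps u x + fps_X) * (1 + fps_const u * fps_X * geom_fps u)"
    by (simp flip: geom_fps_unfold)
  also have "\<dots> = run_fps u x + fps_X + fps_const u * fps_X * run_fps u (Suc x)"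
    by (simp add: algebra_simps)
  finally show ?thesis .
qed

lemma geom_fps_power_eq_run_fps: "geom_fps u ^ x = 1 + fps_const u * run_fps u x"
proof (induction x)
  case (Suc x)
  have "1 + fps_const u * run_fps u (Suc x)
      = (1 + fps_const u * fps_X * geom_fps u) + fps_const u * run_fps u x * geom_fps u"
    by (simp add: algebra_simps)
  also have "\<dots> = geom_fps u * (1 + fps_const u * run_fps u x)"
    unfolding geom_fps_unfold[symmetric] by (simp add: algebra_simps)
  finally show ?case by (simp add: Suc)
qed simp

lemma run_fps_nth_0: "run_fps u x $ 0 = 0"
  by (induction x) auto

text \<open>The factor \<open>fps_X\<close> makes each coefficient depend on earlier ones only. This
  replaces division by 1 - X D.\<close>

lemma fps_shift_unique:
  fixes A B C D :: "'a::comm_ring_1 fps"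
  assumes "A = C + fps_X * D * A" and "B = C + fps_X * D * B"
  shows "A = B"
proof -
  have "A $ n = B $ n" for n
  proof (induction n rule: less_induct)
    case (less n)
    have "(D * A) $ (n - 1) = (D * B) $ (n - 1)" if "n > 0"
      unfolding fps_mult_nth using that by (intro sum.cong) (auto simp: less)
    then show ?case
      by (subst assms(1), subst assms(2)) (simp add: mult.assoc)
  qed
  then show ?thesis by (rule fps_ext)
qed

text \<open>Both sides solve the same implicit equation, by \<open>hd_des_fps_Suc\<close> and
  \<open>run_fps_Suc\<close>.\<close>

lemma hd_des_fps_eq: "x \<le> b \<Longrightarrow> hd_des_fps t b x = run_fps (t - 1) x * des_fps t b"
proof (induction x)
  case (Suc x)
  show ?case
  proof (rule fps_shift_unique)
    show "hd_des_fps t b (Suc x) = (run_fps (t - 1) x + fps_X) * des_fps t b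
        + fps_X * fps_const (t - 1) * hd_des_fps t b (Suc x)"
      using Suc by (subst hd_des_fps_Suc) (simp_all add: algebra_simps)
    show "run_fps (t - 1) (Suc x) * des_fps t b = (run_fps (t - 1) x + fps_X) * des_fps t b
        + fps_X * fps_const (t - 1) * (run_fps (t - 1) (Suc x) * des_fps t b)"
      by (subst run_fps_Suc) (simp only: algebra_simps)
  qed
qed (simp add: hd_des_fps_0)

text \<open>Iterating W = 1 + K W leaves the remainder K ^ (n + 1) W. As K has no constant term, the
  remainder does not reach the coefficient n.\<close>

lemma des_fps_nth: "des_fps t b $ n = (\<Sum>i\<le>n. run_fps (t - 1) b ^ i $ n)"
proof -
  let ?K = "run_fps (t - 1) b" and ?W = "des_fps t b"
  have unfold: "?W = 1 + ?K * ?W"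
    using des_fps_eq_hd_des_fps[of t b] hd_des_fps_eq[of b b t] by simp
  have W: "?W = (\<Sum>i<N. ?K ^ i) + ?K ^ N * ?W" for N
  proof (induction N)
    case (Suc N)
    have "?K ^ N * ?W = ?K ^ N * (1 + ?K * ?W)"
      by (rule arg_cong[OF unfold])
    also have "\<dots> = ?K ^ N + ?K ^ Suc N * ?W" by (simp add: algebra_simps)
    finally show ?case using Suc by (simp add: algebra_simps)
  qed simp
  have "(?K ^ Suc n * ?W) $ n = 0"
    unfolding fps_mult_nth
    by (intro sum.neutral ballI) (simp add: startsby_zero_power_prefix run_fps_nth_0 del: power_Suc)
  then show ?thesis
    by (subst W[of "Suc n"]) (simp only: fps_add_nth fps_sum_nth lessThan_Suc_atMost add_0_right)
qed

section \<open>Coefficient extraction by two binomial inversions\<close>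

text \<open>Inversion in the exponent a of (1 + u K) ^ a = (1 - u z) ^ (- a b). The factor u ^ i
  stays on the left, since a general ring does not allow its cancellation.\<close>

lemma run_fps_power_nth:
  "fact n * (u ^ i * (run_fps u b ^ i $ n)) =
    u ^ n * (\<Sum>m\<le>n. of_nat (stirling n m * b ^ m * (fact i * Stirling m i)))"
proof (rule binomial_transform_inject[where k = i and f = "\<lambda>i. fact n * (u ^ i * (run_fps u b ^ i $ n))"
      and g = "\<lambda>i. u ^ n * (\<Sum>m\<le>n. of_nat (stirling n m * b ^ m * (fact i * Stirling m i)))"])
  fix a
  have "(\<Sum>i\<le>a. of_nat (a choose i) * (fact n * (u ^ i * (run_fps u b ^ i $ n))))
      = fact n * ((\<Sum>i\<le>a. of_nat (a choose i) * (fps_const u * run_fps u b) ^ i) $ n)"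
    by (simp add: fps_sum_nth power_mult_distrib fps_const_power fps_of_nat[symmetric]
          sum_distrib_left algebra_simps del: fps_of_nat)
  also have "(\<Sum>i\<le>a. of_nat (a choose i) * (fps_const u * run_fps u b) ^ i)
      = (fps_const u * run_fps u b + 1) ^ a"
    by (subst binomial_ring) simp
  also have "\<dots> = geom_fps u ^ (b * a)"
    by (simp add: power_mult geom_fps_power_eq_run_fps add.commute)
  also have "fact n * (geom_fps u ^ (b * a) $ n) = u ^ n * of_nat (\<Sum>m\<le>n. stirling n m * (b * a) ^ m)"
    by (simp add: geom_fps_power_nth flip: stirling_pochhammer)
  \<comment> \<open>Only a ^ m is expanded; b ^ m is kept for the inversion in b.\<close>
  also have "(\<Sum>m\<le>n. stirling n m * (b * a) ^ m)
      = (\<Sum>m\<le>n. \<Sum>i\<le>a. (a choose i) * (stirling n m * b ^ m * (fact i * Stirling m i)))"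
    by (simp add: power_mult_distrib power_eq_sum_Stirling[of a] sum_distrib_left algebra_simps)
  also have "\<dots> = (\<Sum>i\<le>a. \<Sum>m\<le>n. (a choose i) * (stirling n m * b ^ m * (fact i * Stirling m i)))"
    by (rule sum.swap)
  also have "u ^ n * of_nat \<dots> = (\<Sum>i\<le>a. of_nat (a choose i) *
      (u ^ n * (\<Sum>m\<le>n. of_nat (stirling n m * b ^ m * (fact i * Stirling m i)))))"
    by (simp add: sum_distrib_left algebra_simps)
  finally show "(\<Sum>i\<le>a. of_nat (a choose i) * (fact n * (u ^ i * (run_fps u b ^ i $ n)))) = \<dots>" .
qed

text \<open>Inversion in the alphabet size b: by \<open>sum_des_words\<close> the coefficients of
  \<open>des_fps t b\<close> form a binomial transform, and b ^ m is expanded to match.\<close>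

lemma sum_des_onto_words:
  fixes t :: "'a::{idom,ring_char_0}"
  assumes "t \<noteq> 1"
  shows "fact n * (\<Sum>w\<in>onto_words k n. t ^ des w) =
    (\<Sum>m\<le>n. of_nat (stirling n m * (fact k * Stirling m k)) *
      (\<Sum>i\<le>m. of_nat (fact i * Stirling m i) * (t - 1) ^ (n - i)))"
proof (rule binomial_transform_inject[where k = k and f = "\<lambda>k. fact n * (\<Sum>w\<in>onto_words k n. t ^ des w)"
      and g = "\<lambda>k. \<Sum>m\<le>n. of_nat (stirling n m * (fact k * Stirling m k)) *
        (\<Sum>i\<le>m. of_nat (fact i * Stirling m i) * (t - 1) ^ (n - i))"])
  fix b
  let ?P = "\<lambda>m. \<Sum>i\<le>m. of_nat (fact i * Stirling m i) * (t - 1) ^ (n - i)"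
  have run: "fact n * (run_fps (t - 1) b ^ i $ n) = (t - 1) ^ (n - i) *
      (\<Sum>m\<le>n. of_nat (stirling n m * b ^ m * (fact i * Stirling m i)))" (is "_ = _ * ?S")
    if "i \<le> n" for i
  proof -
    \<comment> \<open>Here t \<noteq> 1 matters: (t - 1) ^ i is cancelled in an integral
      domain.\<close>
    have "(t - 1) ^ i * (fact n * (run_fps (t - 1) b ^ i $ n)) = (t - 1) ^ n * ?S"
      unfolding run_fps_power_nth[symmetric] by (simp only: mult_ac)
    also have "\<dots> = (t - 1) ^ i * ((t - 1) ^ (n - i) * ?S)"
      using that by (simp flip: mult.assoc power_add)
    finally show ?thesis using assms by simp
  qed
  have "(\<Sum>k\<le>b. of_nat (b choose k) * (fact n * (\<Sum>w\<in>onto_words k n. t ^ des w)))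
      = fact n * (des_fps t b $ n)"
    by (simp add: des_fps_def sum_des_words sum_distrib_left mult.left_commute)
  also have "\<dots> = (\<Sum>i\<le>n. (t - 1) ^ (n - i) *
      (\<Sum>m\<le>n. of_nat (stirling n m * b ^ m * (fact i * Stirling m i))))"
    by (simp add: des_fps_nth sum_distrib_left run)
  also have "\<dots> = (\<Sum>m\<le>n. \<Sum>i\<le>n. of_nat (stirling n m * b ^ m) *
      (of_nat (fact i * Stirling m i) * (t - 1) ^ (n - i)))"
    by (subst sum.swap) (simp add: sum_distrib_left algebra_simps)
  also have "\<dots> = (\<Sum>m\<le>n. of_nat (stirling n m * b ^ m) * ?P m)"
  proof (intro sum.cong refl)
    fix m assume "m \<in> {..n}"
    \<comment> \<open>\<open>Stirling m i\<close> is 0 for i > m.\<close>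
    then have "?P m = (\<Sum>i\<le>n. of_nat (fact i * Stirling m i) * (t - 1) ^ (n - i))"
      by (intro sum.mono_neutral_left) auto
    then show "(\<Sum>i\<le>n. of_nat (stirling n m * b ^ m) *
        (of_nat (fact i * Stirling m i) * (t - 1) ^ (n - i))) = of_nat (stirling n m * b ^ m) * ?P m"
      by (simp only: sum_distrib_left)
  qed
  also have "\<dots> = (\<Sum>m\<le>n. \<Sum>k\<le>b. of_nat (b choose k) *
      (of_nat (stirling n m * (fact k * Stirling m k)) * ?P m))"
    by (simp add: power_eq_sum_Stirling[of b] sum_distrib_left sum_distrib_right mult_ac)
  also have "\<dots> = (\<Sum>k\<le>b. of_nat (b choose k) *
      (\<Sum>m\<le>n. of_nat (stirling n m * (fact k * Stirling m k)) * ?P m))"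
    by (subst sum.swap) (simp add: sum_distrib_left)
  finally show "(\<Sum>k\<le>b. of_nat (b choose k) * (fact n * (\<Sum>w\<in>onto_words k n. t ^ des w))) = \<dots>" .
qed

text \<open>The number k of letters enters \<open>sum_des_onto_words\<close> only through
  \<open>fact k * Stirling m k\<close>, and these sum to \<open>fub m\<close>.\<close>

lemma sum_des_Cay:
  fixes t :: "'a::{idom,ring_char_0}"
  assumes "t \<noteq> 1"
  shows "fact n * (\<Sum>w\<in>Cay n. t ^ des w) =
    (\<Sum>m\<le>n. of_nat (stirling n m) * of_nat (fub m) *
      (\<Sum>i\<le>m. of_nat (Stirling m i) * fact i * (t - 1) ^ (n - i)))"
proof -
  let ?P = "\<lambda>m. \<Sum>i\<le>m. of_nat (fact i * Stirling m i) * (t - 1) ^ (n - i)"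
  have fub: "fub m = (\<Sum>k\<le>n. fact k * Stirling m k)" if "m \<le> n" for m
    unfolding fub_eq_sum_Stirling using that by (intro sum.mono_neutral_left) auto
  have "fact n * (\<Sum>w\<in>Cay n. t ^ des w) =
      (\<Sum>k\<le>n. \<Sum>m\<le>n. of_nat (stirling n m * (fact k * Stirling m k)) * ?P m)"
    unfolding sum_Cay sum_distrib_left[of "fact n"] sum_des_onto_words[OF assms] ..
  also have "\<dots> = (\<Sum>m\<le>n. (\<Sum>k\<le>n. of_nat (stirling n m * (fact k * Stirling m k))) * ?P m)"
    by (subst sum.swap) (simp only: sum_distrib_right)
  also have "\<dots> = (\<Sum>m\<le>n. of_nat (stirling n m) * of_nat (fub m) * ?P m)"
    by (intro sum.cong refl) (simp add: fub flip: sum_distrib_left)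
  finally show ?thesis by (simp add: mult_ac)
qed

theorem theorem4p9:
  fixes n :: nat
  shows "(caylerian n :: 'a::field_char_0 poly) =
    smult (1 / fact n)
      (\<Sum>k=0..n. of_nat (stirling n k) * of_nat (fub k) *
        (\<Sum>i=0..k. of_nat (Stirling k i) * fact i * ([:0, 1:] - 1) ^ (n - i)))"
proof -
  \<comment> \<open>The identity is used with t the polynomial variable itself, an element different
    from 1 of an integral domain.\<close>
  let ?t = "[:0, 1:] :: 'a poly"
  have "[:fact n:] = (fact n :: 'a poly)"
    using of_nat_poly[of "fact n", where ?'a = 'a] by simp
  then have "fact n * p = smult (fact n) p" for p :: "'a poly"
    by (metis mult_pCons_left mult_zero_left pCons_0_0 add_0_right)
  then have "caylerian n = smult (1 / fact n) (fact n * (\<Sum>w\<in>Cay n. ?t ^ des w))"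
    by (simp add: caylerian_def monom_altdef)
  also have "fact n * (\<Sum>w\<in>Cay n. ?t ^ des w) = (\<Sum>m\<le>n. of_nat (stirling n m) * of_nat (fub m) *
      (\<Sum>i\<le>m. of_nat (Stirling m i) * fact i * (?t - 1) ^ (n - i)))"
    by (rule sum_des_Cay) (simp add: one_pCons)
  finally show ?thesis by (simp add: atLeast0AtMost)
qed

end
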